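(* Fix a spreading factor $s$. Under the Poisson rain model, the Laplace transform $\mathcal{L}_{\bar I_s^{(0)}}(z)=\mathbb{E}\{e^{-z\bar I_s^{(0)}}\}$ of the packet-averaged interference $\bar I_s^{(0)}$ received at gateway 0 from the same-spreading-factor users of the typical cell 0 is, for $z>0$, $$\mathcal{L}_{\bar I_s^{(0)}}(z)=\exp\bigg\{\frac{-2\lambda \Delta_s}{1-\Delta_s} E_s^{(0)}(z) \bigg\},\qquad E_s^{(0)}(z)\triangleq A_s\bigg(1+\frac{1}{\bar Q_s^{(0)} z}\ln\frac{1}{1+\bar Q_s^{(0)} z}\bigg).$$
   Context: Gateway (GW) 0 is located above the origin of $\mathbb{R}^2$ at height $H_G>0$. The users with spreading factor $s$ in cell 0 lie in the ring $\mathcal{A}_s\subset\mathbb{R}^2$ of points at horizontal distance between $r_{s-1}$ and $r_s$ from the origin ($0\le r_{s-1}<r_s$), with area $A_s=\pi(r_s^2-r_{s-1}^2)$. The spatial user density is $\lambda>0$, each packet has duration $T_s>0$, the duty cycle is $\Delta_s\in[0,1)$, and the number of packet initiations per user per unit time is $\rho_s\triangleq\frac{1}{T_s/\Delta_s-T_s}=\frac{\Delta_s}{(1-\Delta_s)T_s}$. Channel and power control: the channel power gain from user $k$ at horizontal distance $d_k$ is $g_k=\bar g_k\zeta_k$ with $\bar g_k=\alpha_0(H_G^2+d_k^2)^{-n_0/2}$, $\alpha_0>0$, $n_0\ge 2$, and with $\zeta_k$ i.i.d. exponential random variables of mean 1 (independent of everything else). The transmit power is $P_k=\bar Q_s^{(0)}/\bar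 g_k$, so that the average received power at GW 0 is the same value $\bar Q_s^{(0)}=P_s^{\rm edge}\alpha_0(H_G^2+r_s^2)^{-n_0/2}>0$ for all users with spreading factor $s$ in cell 0, where $P_s^{\rm edge}>0$ is the transmit power of a user at distance $r_s$. Poisson rain model: the interfering packets (the reference packet being excluded) are the points $(\mathbf{w}_k,t_k)$ of a homogeneous Poisson point process $\Phi_s$ on $\mathcal{A}_s\times\mathbb{R}$ (space $\times$ time) with density $\lambda\rho_s$; a point $(\mathbf{w}_k,t_k)$ represents a user at location $\mathbf{w}_k$ transmitting one packet during $[t_k,t_k+T_s)$. The marks $\zeta_k$ are i.i.d. and independent of $\Phi_s$. Interference: the reference packet of the typical user 0 occupies $[0,T_s]$. The instantaneous interference at time $t$ is $I_s^{(0)}(t)=\sum_{k:\,t_k\le t<t_k+T_s}\bar Q_s^{(0)}\zeta_k$, the sum being over points of $\Phi_s$, and the interference averaged over the packet is $\bar I_s^{(0)}\triangleq\frac{1}{T_s}\int_0^{T_s}I_s^{(0)}(t)\,dt$. *)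

theory Defs
  imports "HOL-Probability.Probability"
begin

text \<open>
  A point process is represented by a random enumeration of its points: \<open>\<kappa> \<omega>\<close> is the
  (possibly zero, possibly infinite) number of points, and the points are \<open>X k \<omega>\<close>
  for the indices \<open>k\<close> with \<open>enat k < \<kappa> \<omega>\<close>. The values \<open>X k \<omega>\<close> at other indices are
  never looked at.
\<close>

definition point_count ::
    "('a \<Rightarrow> enat) \<Rightarrow> (nat \<Rightarrow> 'a \<Rightarrow> 'b) \<Rightarrow> 'b set \<Rightarrow> 'a \<Rightarrow> ennreal" where
  "point_count \<kappa> X B \<omega> =
     emeasure (count_space UNIV) {k. enat k < \<kappa> \<omega> \<and> X k \<omega> \<in> B}"

text \<open>
  The Poisson probabilities are written out because \<^const>\<open>poisson_pmf\<close> is only specified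
  for positive rates, whereas sets of intensity 0 must be allowed. They sum to 1 over
  \<open>n :: nat\<close>, so the count in a set of finite intensity is almost surely finite.
\<close>

definition (in prob_space) poisson_point_process ::
    "'b measure \<Rightarrow> ('a \<Rightarrow> enat) \<Rightarrow> (nat \<Rightarrow> 'a \<Rightarrow> 'b) \<Rightarrow> bool" where
  "poisson_point_process \<mu> \<kappa> X \<longleftrightarrow>
     random_variable (count_space UNIV) \<kappa> \<and>
     (\<forall>k. random_variable \<mu> (X k)) \<and>
     (\<forall>B\<in>sets \<mu>. emeasure \<mu> B < \<infinity> \<longrightarrow>
        random_variable borel (point_count \<kappa> X B) \<and>
        (\<forall>n::nat. prob {\<omega>\<in>space M. point_count \<kappa> X B \<omega> = of_nat n} =
           exp (- measure \<mu> B) * measure \<mu> B ^ n / fact n)) \<and>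
     (\<forall>\<B>. finite \<B> \<and> disjoint \<B> \<and> (\<forall>B\<in>\<B>. B \<in> sets \<mu> \<and> emeasure \<mu> B < \<infinity>) \<longrightarrow>
        indep_vars (\<lambda>_. borel) (point_count \<kappa> X) \<B>)"

text \<open>
  Independence of marks and point
  process is independence of the generated sigma-algebras; \<^const>\<open>prob_space.indep_var\<close>
  would require both random elements to have the same type.
\<close>

definition (in prob_space) indep_exp_marks ::
    "'b measure \<Rightarrow> ('a \<Rightarrow> enat) \<Rightarrow> (nat \<Rightarrow> 'a \<Rightarrow> 'b) \<Rightarrow> (nat \<Rightarrow> 'a \<Rightarrow> real) \<Rightarrow> bool" where
  "indep_exp_marks \<mu> \<kappa> X \<zeta> \<longleftrightarrow>
     (\<forall>k. distributed M lborel (\<zeta> k) (exponential_density 1)) \<and>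
     indep_vars (\<lambda>_. borel) \<zeta> UNIV \<and>
     indep_set
       (sets (vimage_algebra (space M) (\<lambda>\<omega>. (\<kappa> \<omega>, \<lambda>k. X k \<omega>))
          (count_space UNIV \<Otimes>\<^sub>M (\<Pi>\<^sub>M k\<in>UNIV. \<mu>))))
       (sets (vimage_algebra (space M) (\<lambda>\<omega> k. \<zeta> k \<omega>) (\<Pi>\<^sub>M k\<in>UNIV. borel)))"

definition cell_ring :: "real \<Rightarrow> real \<Rightarrow> (real^2) set" where
  "cell_ring r_in r_out = {w. r_in \<le> norm w \<and> norm w \<le> r_out}"

definition ring_area :: "real \<Rightarrow> real \<Rightarrow> real" where
  "ring_area r_in r_out = pi * (r_out\<^sup>2 - r_in\<^sup>2)"

text \<open>
  For \<open>\<Delta> > 0\<close> this is \<open>1 / (T / \<Delta> - T)\<close>. The form below also gives the intended rate 0 at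
  \<open>\<Delta> = 0\<close>, where the other one would be \<open>- 1 / T\<close> because \<open>T / 0 = 0\<close>.
\<close>

definition packet_rate :: "real \<Rightarrow> real \<Rightarrow> real" where
  "packet_rate \<Delta> T = \<Delta> / ((1 - \<Delta>) * T)"

definition rain_intensity ::
    "real \<Rightarrow> real \<Rightarrow> real \<Rightarrow> real \<Rightarrow> real \<Rightarrow> ((real^2) \<times> real) measure" where
  "rain_intensity r_in r_out lam \<Delta> T =
     scale_measure (ennreal (lam * packet_rate \<Delta> T))
       (restrict_space lborel (cell_ring r_in r_out \<times> UNIV))"

definition mean_gain :: "real \<Rightarrow> real \<Rightarrow> real \<Rightarrow> real \<Rightarrow> real" where
  "mean_gain \<alpha>\<^sub>0 H n\<^sub>0 d = \<alpha>\<^sub>0 * (H\<^sup>2 + d\<^sup>2) powr (- n\<^sub>0 / 2)"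

definition mean_rx_power :: "real \<Rightarrow> real \<Rightarrow> real \<Rightarrow> real \<Rightarrow> real \<Rightarrow> real" where
  "mean_rx_power \<alpha>\<^sub>0 H n\<^sub>0 P_edge r_out = P_edge * \<alpha>\<^sub>0 * (H\<^sup>2 + r_out\<^sup>2) powr (- n\<^sub>0 / 2)"

definition tx_power :: "real \<Rightarrow> real \<Rightarrow> real \<Rightarrow> real \<Rightarrow> real \<Rightarrow> real \<Rightarrow> real" where
  "tx_power \<alpha>\<^sub>0 H n\<^sub>0 P_edge r_out d =
     mean_rx_power \<alpha>\<^sub>0 H n\<^sub>0 P_edge r_out / mean_gain \<alpha>\<^sub>0 H n\<^sub>0 d"

definition rx_power :: "real \<Rightarrow> real \<Rightarrow> real \<Rightarrow> real \<Rightarrow> real \<Rightarrow> real^2 \<Rightarrow> real \<Rightarrow> real" where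
  "rx_power \<alpha>\<^sub>0 H n\<^sub>0 P_edge r_out w h =
     tx_power \<alpha>\<^sub>0 H n\<^sub>0 P_edge r_out (norm w) * (mean_gain \<alpha>\<^sub>0 H n\<^sub>0 (norm w) * h)"

lemma rx_power_eq:
  assumes "\<alpha>\<^sub>0 > 0" "H > 0"
  shows "rx_power \<alpha>\<^sub>0 H n\<^sub>0 P_edge r_out w h = mean_rx_power \<alpha>\<^sub>0 H n\<^sub>0 P_edge r_out * h"
proof -
  have "H\<^sup>2 + (norm w)\<^sup>2 > 0"
    using assms by (simp add: add_pos_nonneg)
  then have "mean_gain \<alpha>\<^sub>0 H n\<^sub>0 (norm w) \<noteq> 0"
    using assms by (simp add: mean_gain_def)
  then show ?thesis
    by (simp add: rx_power_def tx_power_def)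
qed

text \<open>
  \<open>p w h\<close> is the power received from a user at location \<open>w\<close> with fading mark \<open>h\<close>. For finite
  \<open>\<lambda>\<rho>\<close> and a bounded ring, almost surely only finitely many packets overlap \<open>[0, T]\<close>, so that
  all sums below with \<open>t \<in> [0, T]\<close> are finite sums outside a null event.
\<close>

definition interference ::
    "(real^2 \<Rightarrow> real \<Rightarrow> real) \<Rightarrow> real \<Rightarrow> ('a \<Rightarrow> enat) \<Rightarrow> (nat \<Rightarrow> 'a \<Rightarrow> (real^2) \<times> real) \<Rightarrow>
     (nat \<Rightarrow> 'a \<Rightarrow> real) \<Rightarrow> real \<Rightarrow> 'a \<Rightarrow> real" where
  "interference p T \<kappa> X \<zeta> t \<omega> =
     (\<Sum>\<^sub>\<infinity>k\<in>{k. enat k < \<kappa> \<omega> \<and> snd (X k \<omega>) \<le> t \<and> t < snd (X k \<omega>) + T}.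
        p (fst (X k \<omega>)) (\<zeta> k \<omega>))"

definition avg_interference ::
    "(real^2 \<Rightarrow> real \<Rightarrow> real) \<Rightarrow> real \<Rightarrow> ('a \<Rightarrow> enat) \<Rightarrow> (nat \<Rightarrow> 'a \<Rightarrow> (real^2) \<times> real) \<Rightarrow>
     (nat \<Rightarrow> 'a \<Rightarrow> real) \<Rightarrow> 'a \<Rightarrow> real" where
  "avg_interference p T \<kappa> X \<zeta> \<omega> =
     1 / T * (LBINT t:{0..T}. interference p T \<kappa> X \<zeta> t \<omega>)"

definition laplace_transform :: "'a measure \<Rightarrow> ('a \<Rightarrow> real) \<Rightarrow> real \<Rightarrow> real" where
  "laplace_transform M Y z = (LINT \<omega>|M. exp (- z * Y \<omega>))"

definition E_cell :: "real \<Rightarrow> real \<Rightarrow> real \<Rightarrow> real" where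
  "E_cell A Q z = A * (1 + 1 / (Q * z) * ln (1 / (1 + Q * z)))"

end

theory Submission
  imports Defs
begin

text \<open>
  A packet starting at time \<open>t\<close> overlaps the window \<open>[0, T]\<close> for a duration \<open>max 0 (T - \<bar>t\<bar>)\<close>, and
  power control makes its mean received power equal to \<open>Q\<close>. Hence \<open>z\<close> times the averaged
  interference is almost surely the shot noise \<open>\<Sum> q(t\<^sub>k) \<zeta>\<^sub>k\<close> with \<open>q t = z Q max 0 (1 - \<bar>t\<bar> / T)\<close>.
  Integrating out the exponential marks turns the Laplace transform into the Laplace functional of
  the Poisson process at \<open>ln (1 + q)\<close>, which is \<open>exp (- \<integral> q / (1 + q) d\<mu>)\<close>.
\<close>

section \<open>Preliminaries: joint laws and the exponential series\<close>

text \<open>Independence of the generated sigma-algebras is exactly the product formula on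
  measurable rectangles, and rectangles determine a product measure. This turns the independence
  clause of \<open>indep_exp_marks\<close>, whose two random elements have different types, into a
  statement to which Tonelli applies.\<close>

lemma (in prob_space) distr_pair_indep_vimage_algebra:
  assumes [measurable]: "U \<in> measurable M N1" "V \<in> measurable M N2"
    and indep: "indep_set (sets (vimage_algebra (space M) U N1)) (sets (vimage_algebra (space M) V N2))"
  shows "distr M (N1 \<Otimes>\<^sub>M N2) (\<lambda>\<omega>. (U \<omega>, V \<omega>)) = distr M N1 U \<Otimes>\<^sub>M distr M N2 V"
proof (rule pair_measure_eqI[symmetric])
  show "sigma_finite_measure (distr M N1 U)" "sigma_finite_measure (distr M N2 V)"
    by (auto intro!: prob_space_imp_sigma_finite prob_space_distr)
next
  fix A B assume A: "A \<in> sets (distr M N1 U)" and B: "B \<in> sets (distr M N2 V)"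
  then have [measurable]: "A \<in> sets N1" "B \<in> sets N2" by auto
  have "prob ((U -` A \<inter> space M) \<inter> (V -` B \<inter> space M)) =
      prob (U -` A \<inter> space M) * prob (V -` B \<inter> space M)"
    by (rule indep_setD[OF indep]) (auto intro!: in_vimage_algebra)
  moreover have "(\<lambda>\<omega>. (U \<omega>, V \<omega>)) -` (A \<times> B) \<inter> space M =
      (U -` A \<inter> space M) \<inter> (V -` B \<inter> space M)"
    by auto
  ultimately show "emeasure (distr M N1 U) A * emeasure (distr M N2 V) B =
      emeasure (distr M (N1 \<Otimes>\<^sub>M N2) (\<lambda>\<omega>. (U \<omega>, V \<omega>))) (A \<times> B)"
    by (simp add: emeasure_distr emeasure_eq_measure ennreal_mult)
qed simp

lemma exp_series_sums: "(\<lambda>n. x ^ n / fact n) sums exp (x::real)"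
  using exp_converges[of x] by (simp add: scaleR_conv_of_real divide_inverse mult.commute)

section \<open>Counts with a Poisson law\<close>

context prob_space
begin

context
  fixes N :: "'a \<Rightarrow> ennreal" and m :: real
  assumes N_meas [measurable]: "N \<in> borel_measurable M"
    and m_nonneg: "0 \<le> m"
    and N_prob: "\<And>n::nat. prob {\<omega>\<in>space M. N \<omega> = of_nat n} = exp (- m) * m ^ n / fact n"
begin

text \<open>The Poisson weights already sum to 1, so no mass is left for infinity or for non-integer
  values of \<open>N\<close>.\<close>

lemma poisson_AE_nat: "AE \<omega> in M. \<exists>n::nat. N \<omega> = of_nat n"
proof -
  have "(\<lambda>n. prob {\<omega>\<in>space M. N \<omega> = of_nat n}) sums prob (\<Union>n. {\<omega>\<in>space M. N \<omega> = of_nat n})"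
    by (rule finite_measure_UNION) (auto simp: disjoint_family_on_def)
  moreover have "(\<lambda>n. prob {\<omega>\<in>space M. N \<omega> = of_nat n}) sums (exp (- m) * exp m)"
    unfolding N_prob using sums_mult[OF exp_series_sums[of m], of "exp (- m)"] by simp
  ultimately have "prob (\<Union>n. {\<omega>\<in>space M. N \<omega> = of_nat n}) = 1"
    by (simp add: sums_unique2 flip: exp_add)
  then have "AE \<omega> in M. \<omega> \<in> (\<Union>n. {\<omega>\<in>space M. N \<omega> = of_nat n})"
    by (subst prob_eq_1[symmetric]) auto
  then show ?thesis by eventually_elim auto
qed

text \<open>Splitting over the events \<open>N = n\<close> gives the exponential series with
  parameter \<open>m * exp (- c)\<close> in place of \<open>m\<close>.\<close>

lemma poisson_laplace:
  assumes "0 \<le> c"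
  shows "(\<integral>\<omega>. exp (- c * enn2real (N \<omega>)) \<partial>M) = exp (- (m * (1 - exp (- c))))"
proof -
  have "(\<integral>\<^sup>+\<omega>. ennreal (exp (- c * enn2real (N \<omega>))) \<partial>M) =
      (\<integral>\<^sup>+\<omega>. (\<Sum>n::nat. ennreal (exp (- c) ^ n) * indicator {\<omega>\<in>space M. N \<omega> = of_nat n} \<omega>) \<partial>M)"
  proof (rule nn_integral_cong_AE)
    show "AE \<omega> in M. ennreal (exp (- c * enn2real (N \<omega>))) =
       (\<Sum>n::nat. ennreal (exp (- c) ^ n) * indicator {\<omega>\<in>space M. N \<omega> = of_nat n} \<omega>)"
      using poisson_AE_nat AE_space
    proof eventually_elim
      case (elim \<omega>)
      then obtain n :: nat where n: "N \<omega> = of_nat n" by auto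
      \<comment> \<open>The events for different values are disjoint, so only the term of the
        attained value survives.\<close>
      have "(\<Sum>k::nat. ennreal (exp (- c) ^ k) * indicator {\<omega>\<in>space M. N \<omega> = of_nat k} \<omega>) =
          (\<Sum>k\<in>{n}. ennreal (exp (- c) ^ k) * indicator {\<omega>\<in>space M. N \<omega> = of_nat k} \<omega>)"
        by (rule suminf_finite) (auto simp: n indicator_def)
      then show ?case
        using elim n by (simp add: enn2real_of_nat exp_of_nat_mult[symmetric] mult.commute)
    qed
  qed
  also have "\<dots> = (\<Sum>n::nat. \<integral>\<^sup>+\<omega>. ennreal (exp (- c) ^ n) * indicator {\<omega>\<in>space M. N \<omega> = of_nat n} \<omega> \<partial>M)"
    by (rule nn_integral_suminf) measurable
  also have "\<dots> = (\<Sum>n::nat. ennreal (exp (- m) * ((m * exp (- c)) ^ n / fact n)))"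
    by (intro suminf_cong)
       (simp add: nn_integral_cmult_indicator emeasure_eq_measure N_prob m_nonneg
          power_mult_distrib mult_ac flip: ennreal_mult)
  also have "\<dots> = ennreal (exp (- m) * exp (m * exp (- c)))"
    using sums_mult[OF exp_series_sums[of "m * exp (- c)"], of "exp (- m)"] m_nonneg
    by (intro suminf_ennreal_eq) auto
  also have "exp (- m) * exp (m * exp (- c)) = exp (- (m * (1 - exp (- c))))"
    by (simp add: algebra_simps flip: exp_add)
  finally show ?thesis
    by (subst integral_eq_nn_integral) auto
qed

end

section \<open>The Laplace functional of a Poisson process\<close>

lemma poisson_point_processD:
  assumes "poisson_point_process \<mu> \<kappa> X"
  shows "\<kappa> \<in> measurable M (count_space UNIV)"
    and "\<And>k. X k \<in> measurable M \<mu>"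
    and "\<And>B. B \<in> sets \<mu> \<Longrightarrow> emeasure \<mu> B < \<infinity> \<Longrightarrow> point_count \<kappa> X B \<in> borel_measurable M"
    and "\<And>B n. B \<in> sets \<mu> \<Longrightarrow> emeasure \<mu> B < \<infinity> \<Longrightarrow>
      prob {\<omega>\<in>space M. point_count \<kappa> X B \<omega> = of_nat n} = exp (- measure \<mu> B) * measure \<mu> B ^ n / fact n"
    and "\<And>\<B>. finite \<B> \<Longrightarrow> disjoint \<B> \<Longrightarrow> (\<And>B. B \<in> \<B> \<Longrightarrow> B \<in> sets \<mu> \<and> emeasure \<mu> B < \<infinity>) \<Longrightarrow>
      indep_vars (\<lambda>_. borel) (point_count \<kappa> X) \<B>"
  using assms unfolding poisson_point_process_def by blast+

lemma poisson_AE_finite_points: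
  assumes P: "poisson_point_process \<mu> \<kappa> X" and B: "B \<in> sets \<mu>" "emeasure \<mu> B < \<infinity>"
  shows "AE \<omega> in M. finite {k. enat k < \<kappa> \<omega> \<and> X k \<omega> \<in> B}"
  using poisson_AE_nat[OF poisson_point_processD(3)[OF P B] measure_nonneg poisson_point_processD(4)[OF P B]]
  by eventually_elim (auto simp: point_count_def emeasure_count_space split: if_splits)

text \<open>For a simple function the sum over the points is a linear combination of counts in the
  disjoint level sets. These counts are independent Poisson variables, so the expectation factors
  into the transforms of \<open>poisson_laplace\<close>, and the exponents add up to the
  integral.\<close>

lemma poisson_laplace_functional_simple:
  fixes s :: "'b \<Rightarrow> real"
  assumes P: "poisson_point_process \<mu> \<kappa> X" and B: "B \<in> sets \<mu>" "emeasure \<mu> B < \<infinity>"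
    and s: "simple_function \<mu> s" and nonneg: "\<And>x. x \<in> space \<mu> \<Longrightarrow> 0 \<le> s x"
    and supp: "\<And>x. x \<in> space \<mu> \<Longrightarrow> x \<notin> B \<Longrightarrow> s x = 0"
  shows "(\<integral>\<omega>. exp (- (\<Sum>k. if enat k < \<kappa> \<omega> then s (X k \<omega>) else 0)) \<partial>M) =
    exp (- (\<integral>x. 1 - exp (- s x) \<partial>\<mu>))"
proof -
  note [measurable] = poisson_point_processD(1,2)[OF P] borel_measurable_simple_function[OF s]
  \<comment> \<open>The value 0 is left out because its level set may have infinite intensity; all
    other level sets lie in \<open>B\<close>.\<close>
  define C where "C = s ` space \<mu> - {0}"
  define L where "L c = s -` {c} \<inter> space \<mu>" for c
  have finC: "finite C"
    using s by (auto simp: C_def simple_function_def)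
  have L_sets [measurable]: "L c \<in> sets \<mu>" for c
    using s unfolding L_def by (rule simple_functionD)
  have L_sub: "L c \<subseteq> B" if "c \<in> C" for c
    using that supp by (auto simp: L_def C_def)
  have L_fin: "emeasure \<mu> (L c) < \<infinity>" if "c \<in> C" for c
    using emeasure_mono[OF L_sub[OF that] B(1)] B(2) by (rule le_less_trans)
  have L_inj: "inj_on L C"
    by (auto simp: L_def C_def inj_on_def)
  have L_disj: "disjoint (L ` C)"
    by (auto simp: L_def disjoint_def)
  have C_nonneg: "0 \<le> c" if "c \<in> C" for c
    using that nonneg by (auto simp: C_def)
  \<comment> \<open>Used twice: with the identity for the sum over the points, and with 1 - exp (-
    x) for the integral in the exponent.\<close>
  have s_sum: "g (s x) = (\<Sum>c\<in>C. g c * indicator (L c) x)" if "x \<in> space \<mu>" "g 0 = 0" for x and g :: "real \<Rightarrow> real"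
  proof -
    have "(\<Sum>c\<in>C. g c * indicator (L c) x) = (\<Sum>c\<in>C. if c = s x then g c else 0)"
      using that(1) by (intro sum.cong) (auto simp: L_def)
    also have "\<dots> = g (s x)"
      using that finC by (auto simp: C_def)
    finally show ?thesis by simp
  qed
  \<comment> \<open>Independence is stated for counts indexed by the sets themselves. Hence the
    product over values is reindexed over level sets, and \<open>v\<close> recovers the value from
    its set.\<close>
  define v where "v = the_inv_into C L"
  have v: "v (L c) = c" if "c \<in> C" for c
    unfolding v_def by (rule the_inv_into_f_f[OF L_inj that])
  have indep: "indep_vars (\<lambda>_. borel) (point_count \<kappa> X) (L ` C)"
    using finC L_disj L_fin by (intro poisson_point_processD(5)[OF P]) auto
  have "(\<integral>\<omega>. exp (- (\<Sum>k. if enat k < \<kappa> \<omega> then s (X k \<omega>) else 0)) \<partial>M) =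
      (\<integral>\<omega>. (\<Prod>c\<in>C. exp (- c * enn2real (point_count \<kappa> X (L c) \<omega>))) \<partial>M)"
  proof (rule integral_cong_AE)
    have [measurable]: "point_count \<kappa> X (L c) \<in> borel_measurable M" if "c \<in> C" for c
      using poisson_point_processD(3)[OF P L_sets L_fin[OF that]] .
    show "(\<lambda>\<omega>. \<Prod>c\<in>C. exp (- c * enn2real (point_count \<kappa> X (L c) \<omega>))) \<in> borel_measurable M"
      by measurable
    show "AE \<omega> in M. exp (- (\<Sum>k. if enat k < \<kappa> \<omega> then s (X k \<omega>) else 0)) =
        (\<Prod>c\<in>C. exp (- c * enn2real (point_count \<kappa> X (L c) \<omega>)))"
      using poisson_AE_finite_points[OF P B] AE_space
    proof eventually_elim
      case (elim \<omega>)
      let ?K = "{k. enat k < \<kappa> \<omega> \<and> X k \<omega> \<in> B}"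
      have sp: "X k \<omega> \<in> space \<mu>" for k
        using elim(2) measurable_space[OF poisson_point_processD(2)[OF P]] by auto
      have "(\<Sum>k. if enat k < \<kappa> \<omega> then s (X k \<omega>) else 0) =
          (\<Sum>k\<in>?K. if enat k < \<kappa> \<omega> then s (X k \<omega>) else 0)"
        by (rule suminf_finite[OF elim(1)]) (use supp sp in auto)
      also have "\<dots> = (\<Sum>k\<in>?K. \<Sum>c\<in>C. c * indicator (L c) (X k \<omega>))"
        using s_sum[of _ "\<lambda>x. x"] sp by (intro sum.cong) auto
      also have "\<dots> = (\<Sum>c\<in>C. c * (\<Sum>k\<in>?K. indicator (L c) (X k \<omega>)))"
        by (subst sum.swap) (simp add: sum_distrib_left)
      also have "\<dots> = (\<Sum>c\<in>C. c * enn2real (point_count \<kappa> X (L c) \<omega>))"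
      proof (intro sum.cong arg_cong2[of _ _ _ _ "(*)"] refl)
        fix c assume c: "c \<in> C"
        have eq: "{k. enat k < \<kappa> \<omega> \<and> X k \<omega> \<in> L c} = {k \<in> ?K. X k \<omega> \<in> L c}"
          using L_sub[OF c] by auto
        show "(\<Sum>k\<in>?K. indicator (L c) (X k \<omega>)) = enn2real (point_count \<kappa> X (L c) \<omega>)"
          using elim(1)
          by (simp add: point_count_def eq emeasure_count_space indicator_def sum.If_cases enn2real_of_nat
                Int_def conj_ac)
      qed
      finally show ?case
        using finC by (simp add: exp_sum sum_negf[symmetric] del: sum_negf)
    qed
  qed measurable
  also have "\<dots> = (\<integral>\<omega>. (\<Prod>D\<in>L ` C. exp (- v D * enn2real (point_count \<kappa> X D \<omega>))) \<partial>M)"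
    by (simp add: prod.reindex[OF L_inj] v)
  also have "\<dots> = (\<Prod>D\<in>L ` C. \<integral>\<omega>. exp (- v D * enn2real (point_count \<kappa> X D \<omega>)) \<partial>M)"
  proof (rule indep_vars_lebesgue_integral)
    show "indep_vars (\<lambda>_. borel) (\<lambda>D \<omega>. exp (- v D * enn2real (point_count \<kappa> X D \<omega>))) (L ` C)"
      by (rule indep_vars_compose2[OF indep]) measurable
    fix D assume "D \<in> L ` C"
    then obtain c where c: "c \<in> C" "D = L c" by auto
    have [measurable]: "point_count \<kappa> X (L c) \<in> borel_measurable M"
      using poisson_point_processD(3)[OF P L_sets L_fin[OF c(1)]] .
    show "integrable M (\<lambda>\<omega>. exp (- v D * enn2real (point_count \<kappa> X D \<omega>)))"
      by (rule integrable_const_bound[of _ 1]) (auto simp: c v C_nonneg)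
  qed (use finC in auto)
  also have "\<dots> = (\<Prod>c\<in>C. \<integral>\<omega>. exp (- c * enn2real (point_count \<kappa> X (L c) \<omega>)) \<partial>M)"
    by (simp add: prod.reindex[OF L_inj] v)
  also have "\<dots> = (\<Prod>c\<in>C. exp (- (measure \<mu> (L c) * (1 - exp (- c)))))"
    using poisson_point_processD(3,4)[OF P L_sets L_fin] C_nonneg
    by (intro prod.cong refl poisson_laplace) auto
  also have "\<dots> = exp (- (\<Sum>c\<in>C. measure \<mu> (L c) * (1 - exp (- c))))"
    using finC by (simp add: exp_sum sum_negf[symmetric] del: sum_negf)
  also have "(\<Sum>c\<in>C. measure \<mu> (L c) * (1 - exp (- c))) =
      (\<Sum>c\<in>C. \<integral>x. (1 - exp (- c)) * indicator (L c) x \<partial>\<mu>)"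
    by (simp add: mult.commute)
  also have "\<dots> = (\<integral>x. (\<Sum>c\<in>C. (1 - exp (- c)) * indicator (L c) x) \<partial>\<mu>)"
    using L_fin by (subst Bochner_Integration.integral_sum) auto
  also have "\<dots> = (\<integral>x. 1 - exp (- s x) \<partial>\<mu>)"
    using s_sum[of _ "\<lambda>x. 1 - exp (- x)"] by (intro Bochner_Integration.integral_cong) auto
  finally show ?thesis .
qed

text \<open>Approximation by simple functions vanishing off \<open>B\<close>, with dominated
  convergence on both sides: the constant 1 dominates on the probability space, the indicator of
  \<open>B\<close> on the intensity side. Almost surely only finitely many points lie in
  \<open>B\<close>, so the convergence inside the exponential is that of finite sums.\<close>

lemma poisson_laplace_functional:
  fixes h :: "'b \<Rightarrow> real"
  assumes P: "poisson_point_process \<mu> \<kappa> X" and B: "B \<in> sets \<mu>" "emeasure \<mu> B < \<infinity>"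
    and h [measurable]: "h \<in> borel_measurable \<mu>" and nonneg: "\<And>x. x \<in> space \<mu> \<Longrightarrow> 0 \<le> h x"
    and supp: "\<And>x. x \<in> space \<mu> \<Longrightarrow> x \<notin> B \<Longrightarrow> h x = 0"
  shows "(\<integral>\<omega>. exp (- (\<Sum>k. if enat k < \<kappa> \<omega> then h (X k \<omega>) else 0)) \<partial>M) =
    exp (- (\<integral>x. 1 - exp (- h x) \<partial>\<mu>))"
proof -
  note [measurable] = poisson_point_processD(1,2)[OF P]
  obtain f where f: "\<And>i. simple_function \<mu> (f i)"
      "\<And>x. x \<in> space \<mu> \<Longrightarrow> (\<lambda>i. f i x) \<longlonglongrightarrow> h x"
      "\<And>i x. x \<in> space \<mu> \<Longrightarrow> norm (f i x) \<le> 2 * norm (h x)"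
    using borel_measurable_implies_sequence_metric[OF h, of 0] by simp metis
  \<comment> \<open>The approximants \<open>f i\<close> may be negative. Absolute values repair this
    without changing the limit, since \<open>h\<close> is nonnegative; the bound by 2 * norm (h x)
    forces them to vanish wherever \<open>h\<close> does.\<close>
  define s where "s i x = \<bar>f i x\<bar>" for i x
  have s: "simple_function \<mu> (s i)" for i
    unfolding s_def using f(1) by (rule simple_function_compose1)
  note [measurable] = borel_measurable_simple_function[OF s]
  have s_lim: "(\<lambda>i. s i x) \<longlonglongrightarrow> h x" if "x \<in> space \<mu>" for x
    unfolding s_def using tendsto_rabs[OF f(2)[OF that]] nonneg[OF that] by simp
  have s_nonneg: "0 \<le> s i x" for i x
    by (simp add: s_def)
  have s_supp: "s i x = 0" if "x \<in> space \<mu>" "x \<notin> B" for i x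
    using f(3)[OF that(1), of i] supp[OF that] by (simp add: s_def)
  have sp: "X k \<omega> \<in> space \<mu>" if "\<omega> \<in> space M" for k \<omega>
    using that measurable_space[OF poisson_point_processD(2)[OF P]] by auto
  have sum_eq: "(\<Sum>k. if enat k < \<kappa> \<omega> then u (X k \<omega>) else 0) = (\<Sum>k | enat k < \<kappa> \<omega> \<and> X k \<omega> \<in> B. u (X k \<omega>))"
    if "finite {k. enat k < \<kappa> \<omega> \<and> X k \<omega> \<in> B}" "\<omega> \<in> space M"
      "\<And>x. x \<in> space \<mu> \<Longrightarrow> x \<notin> B \<Longrightarrow> u x = 0" for \<omega> and u :: "'b \<Rightarrow> real"
    using that(3) sp[OF that(2)] by (subst suminf_finite[OF that(1)]) auto
  have "(\<lambda>i. \<integral>\<omega>. exp (- (\<Sum>k. if enat k < \<kappa> \<omega> then s i (X k \<omega>) else 0)) \<partial>M)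
      \<longlonglongrightarrow> (\<integral>\<omega>. exp (- (\<Sum>k. if enat k < \<kappa> \<omega> then h (X k \<omega>) else 0)) \<partial>M)"
  proof (rule integral_dominated_convergence[where w = "\<lambda>_. 1"])
    show "AE \<omega> in M. (\<lambda>i. exp (- (\<Sum>k. if enat k < \<kappa> \<omega> then s i (X k \<omega>) else 0)))
        \<longlonglongrightarrow> exp (- (\<Sum>k. if enat k < \<kappa> \<omega> then h (X k \<omega>) else 0))"
      using poisson_AE_finite_points[OF P B] AE_space
    proof eventually_elim
      case (elim \<omega>)
      have "(\<lambda>i. exp (- (\<Sum>k | enat k < \<kappa> \<omega> \<and> X k \<omega> \<in> B. s i (X k \<omega>))))
          \<longlonglongrightarrow> exp (- (\<Sum>k | enat k < \<kappa> \<omega> \<and> X k \<omega> \<in> B. h (X k \<omega>)))"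
        by (intro tendsto_intros s_lim sp elim)
      then show ?case
        using sum_eq[OF elim, of h] sum_eq[OF elim, of "s _"] supp s_supp by simp
    qed
    show "AE \<omega> in M. norm (exp (- (\<Sum>k. if enat k < \<kappa> \<omega> then s i (X k \<omega>) else 0))) \<le> 1" for i
      using poisson_AE_finite_points[OF P B] AE_space
    proof eventually_elim
      case (elim \<omega>)
      show ?case
        using sum_eq[OF elim, of "s i"] s_supp by (simp add: sum_nonneg s_nonneg)
    qed
  qed auto
  moreover have "(\<lambda>i. exp (- (\<integral>x. 1 - exp (- s i x) \<partial>\<mu>))) \<longlonglongrightarrow> exp (- (\<integral>x. 1 - exp (- h x) \<partial>\<mu>))"
  proof (intro tendsto_exp tendsto_minus integral_dominated_convergence[where w = "indicator B"])
    show "AE x in \<mu>. (\<lambda>i. 1 - exp (- s i x)) \<longlonglongrightarrow> 1 - exp (- h x)"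
      by (intro AE_I2 tendsto_intros s_lim)
    show "AE x in \<mu>. norm (1 - exp (- s i x)) \<le> indicator B x" for i
      using s_nonneg s_supp by (intro AE_I2) (auto simp: indicator_def)
  qed (use B in auto)
  moreover have "(\<integral>\<omega>. exp (- (\<Sum>k. if enat k < \<kappa> \<omega> then s i (X k \<omega>) else 0)) \<partial>M) =
      exp (- (\<integral>x. 1 - exp (- s i x) \<partial>\<mu>))" for i
    by (rule poisson_laplace_functional_simple[OF P B s]) (use s_nonneg s_supp in auto)
  ultimately show ?thesis
    by (simp add: LIMSEQ_unique)
qed

section \<open>Integrating out the exponential marks\<close>

text \<open>Multiplying the rate 1 density by exp (- c * x) gives 1 / (1 + c) times the density of
  rate 1 + c, which has total mass 1.\<close>

lemma exponential_laplace:
  assumes Z: "distributed M lborel Z (exponential_density 1)" and c: "0 \<le> c"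
  shows "(\<integral>\<^sup>+\<omega>. ennreal (exp (- c * Z \<omega>)) \<partial>M) = ennreal (1 / (1 + c))"
proof -
  interpret E: prob_space "density lborel (exponential_density (1 + c))"
    using c by (intro prob_space_exponential_density) auto
  have one: "(\<integral>\<^sup>+x. ennreal (exponential_density (1 + c) x) \<partial>lborel) = 1"
    using E.emeasure_space_1 by (simp add: emeasure_density)
  have "(\<integral>\<^sup>+\<omega>. ennreal (exp (- c * Z \<omega>)) \<partial>M) =
      (\<integral>\<^sup>+x. ennreal (exponential_density 1 x) * ennreal (exp (- c * x)) \<partial>lborel)"
    by (rule distributed_nn_integral[OF Z, symmetric]) measurable
  also have "\<dots> = (\<integral>\<^sup>+x. ennreal (1 / (1 + c)) * ennreal (exponential_density (1 + c) x) \<partial>lborel)"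
    using c by (intro nn_integral_cong)
       (auto simp: exponential_density_def distrib_left simp flip: ennreal_mult exp_add)
  also have "\<dots> = ennreal (1 / (1 + c))"
    by (simp add: nn_integral_cmult one)
  finally show ?thesis .
qed

lemma exponential_AE_nonneg:
  assumes Z: "distributed M lborel Z (exponential_density 1)"
  shows "AE \<omega> in M. 0 \<le> Z \<omega>"
proof -
  have [measurable]: "Z \<in> borel_measurable M"
    using distributed_measurable[OF Z] by simp
  have "AE x in distr M lborel Z. 0 \<le> x"
    unfolding distributed_distr_eq_density[OF Z]
    by (subst AE_density) (auto simp: exponential_density_def)
  then show ?thesis
    by (subst (asm) AE_distr_iff) auto
qed

lemma indep_exp_marksD:
  assumes "indep_exp_marks \<mu> \<kappa> X \<zeta>"
  shows "distributed M lborel (\<zeta> k) (exponential_density 1)"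
    and "indep_vars (\<lambda>_. borel) \<zeta> UNIV"
    and "\<zeta> k \<in> borel_measurable M"
  using assms distributed_measurable[of M lborel "\<zeta> k"] unfolding indep_exp_marks_def by auto

text \<open>Points and marks have a product joint law, so by Tonelli the marks can be integrated
  first with the points frozen. Then they are independent exponentials with fixed coefficients, and
  each contributes its own transform. Indices beyond the number of points get coefficient 0, hence
  the factor 1 on both sides. Only finitely many factors are taken here; the limit comes
  afterwards.\<close>

lemma exp_marks_integrate_out:
  fixes a :: "'b \<Rightarrow> real"
  assumes [measurable]: "\<kappa> \<in> measurable M (count_space UNIV)" and X [measurable]: "\<And>k. X k \<in> measurable M \<mu>"
    and Z: "indep_exp_marks \<mu> \<kappa> X \<zeta>"
    and a [measurable]: "a \<in> borel_measurable \<mu>" and nonneg: "\<And>x. x \<in> space \<mu> \<Longrightarrow> 0 \<le> a x"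
  shows "(\<integral>\<omega>. (\<Prod>k<n. exp (- (if enat k < \<kappa> \<omega> then a (X k \<omega>) else 0) * \<zeta> k \<omega>)) \<partial>M) =
    (\<integral>\<omega>. (\<Prod>k<n. 1 / (1 + (if enat k < \<kappa> \<omega> then a (X k \<omega>) else 0))) \<partial>M)"
proof -
  note [measurable] = indep_exp_marksD(3)[OF Z]
  define N1 where "N1 = count_space (UNIV::enat set) \<Otimes>\<^sub>M (\<Pi>\<^sub>M k\<in>(UNIV::nat set). \<mu>)"
  define N2 where "N2 = (\<Pi>\<^sub>M k\<in>(UNIV::nat set). (borel::real measure))"
  define U where "U \<omega> = (\<kappa> \<omega>, \<lambda>k. X k \<omega>)" for \<omega>
  define V where "V \<omega> = (\<lambda>k. \<zeta> k \<omega>)" for \<omega>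
  define A where "A k u = (if enat k < fst u then a (snd u k) else 0)" for k and u :: "enat \<times> (nat \<Rightarrow> 'b)"
  have U [measurable]: "U \<in> measurable M N1"
    unfolding U_def N1_def by (intro measurable_Pair measurable_PiM_single') (auto simp: measurable_space[OF X])
  have V [measurable]: "V \<in> measurable M N2"
    unfolding V_def N2_def by (intro measurable_PiM_single') auto
  have A [measurable]: "A k \<in> borel_measurable N1" for k
    unfolding A_def N1_def by measurable
  have N2_comp [measurable]: "(\<lambda>v. v k) \<in> borel_measurable N2" for k
    unfolding N2_def by measurable
  have A_nonneg: "0 \<le> A k u" if "u \<in> space N1" for k u
    using that nonneg by (auto simp: A_def N1_def space_pair_measure space_PiM PiE_iff)
  have AU: "A k (U \<omega>) = (if enat k < \<kappa> \<omega> then a (X k \<omega>) else 0)" for k \<omega>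
    by (simp add: A_def U_def)
  interpret V: prob_space "distr M N2 V"
    by (rule prob_space_distr) fact
  have joint: "distr M (N1 \<Otimes>\<^sub>M N2) (\<lambda>\<omega>. (U \<omega>, V \<omega>)) = distr M N1 U \<Otimes>\<^sub>M distr M N2 V"
    using Z U V unfolding indep_exp_marks_def
    by (intro distr_pair_indep_vimage_algebra) (auto simp: U_def[abs_def] V_def[abs_def] N1_def N2_def)
  \<comment> \<open>The inner integral, for deterministic coefficients \<open>c\<close>.\<close>
  have fixed: "(\<integral>\<^sup>+\<omega>. (\<Prod>k<n. ennreal (exp (- c k * \<zeta> k \<omega>))) \<partial>M) = (\<Prod>k<n. ennreal (1 / (1 + c k)))"
    if c: "\<And>k. 0 \<le> c k" for c :: "nat \<Rightarrow> real"
  proof -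
    have "indep_vars (\<lambda>_. borel) (\<lambda>k \<omega>. ennreal (exp (- c k * \<zeta> k \<omega>))) {..<n}"
      by (rule indep_vars_compose2[OF indep_vars_subset[OF indep_exp_marksD(2)[OF Z]]]) auto
    then have "(\<integral>\<^sup>+\<omega>. (\<Prod>k<n. ennreal (exp (- c k * \<zeta> k \<omega>))) \<partial>M) =
        (\<Prod>k<n. \<integral>\<^sup>+\<omega>. ennreal (exp (- c k * \<zeta> k \<omega>)) \<partial>M)"
      by (intro indep_vars_nn_integral) auto
    also have "\<dots> = (\<Prod>k<n. ennreal (1 / (1 + c k)))"
      by (intro prod.cong refl exponential_laplace indep_exp_marksD(1)[OF Z] c)
    finally show ?thesis .
  qed
  have "(\<integral>\<^sup>+\<omega>. (\<Prod>k<n. ennreal (exp (- A k (U \<omega>) * V \<omega> k))) \<partial>M) =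
      (\<integral>\<^sup>+(u, v). (\<Prod>k<n. ennreal (exp (- A k u * v k))) \<partial>distr M (N1 \<Otimes>\<^sub>M N2) (\<lambda>\<omega>. (U \<omega>, V \<omega>)))"
    by (subst nn_integral_distr) (auto simp: case_prod_unfold)
  also have "\<dots> = (\<integral>\<^sup>+u. \<integral>\<^sup>+v. (\<Prod>k<n. ennreal (exp (- A k u * v k))) \<partial>distr M N2 V \<partial>distr M N1 U)"
    unfolding joint by (subst V.nn_integral_fst[symmetric]) (auto simp: case_prod_unfold)
  also have "\<dots> = (\<integral>\<^sup>+u. (\<Prod>k<n. ennreal (1 / (1 + A k u))) \<partial>distr M N1 U)"
  proof (rule nn_integral_cong)
    fix u assume "u \<in> space (distr M N1 U)"
    then have u [measurable]: "u \<in> space N1" by simp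
    show "(\<integral>\<^sup>+v. (\<Prod>k<n. ennreal (exp (- A k u * v k))) \<partial>distr M N2 V) = (\<Prod>k<n. ennreal (1 / (1 + A k u)))"
      using fixed[OF A_nonneg[OF u]] by (subst nn_integral_distr) (auto simp: V_def)
  qed
  also have "\<dots> = (\<integral>\<^sup>+\<omega>. (\<Prod>k<n. ennreal (1 / (1 + A k (U \<omega>)))) \<partial>M)"
    by (rule nn_integral_distr) measurable
  finally have eq: "(\<integral>\<^sup>+\<omega>. (\<Prod>k<n. ennreal (exp (- A k (U \<omega>) * V \<omega> k))) \<partial>M) =
      (\<integral>\<^sup>+\<omega>. (\<Prod>k<n. ennreal (1 / (1 + A k (U \<omega>)))) \<partial>M)" .
  have "(\<integral>\<omega>. (\<Prod>k<n. exp (- A k (U \<omega>) * V \<omega> k)) \<partial>M) = (\<integral>\<omega>. (\<Prod>k<n. 1 / (1 + A k (U \<omega>))) \<partial>M)"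
  proof -
    have nn: "0 \<le> 1 / (1 + A k (U \<omega>))" if "\<omega> \<in> space M" for k \<omega>
      using A_nonneg[OF measurable_space[OF U that], of k] by simp
    have "(\<integral>\<^sup>+\<omega>. ennreal (\<Prod>k<n. exp (- A k (U \<omega>) * V \<omega> k)) \<partial>M) =
        (\<integral>\<^sup>+\<omega>. ennreal (\<Prod>k<n. 1 / (1 + A k (U \<omega>))) \<partial>M)"
      using eq nn by (simp add: prod_ennreal cong: nn_integral_cong)
    then show ?thesis
      using nn by (subst (1 2) integral_eq_nn_integral) (auto intro!: prod_nonneg)
  qed
  then show ?thesis
    by (simp only: AU) (simp add: V_def)
qed

text \<open>The marks are integrated out over the first \<open>n\<close> indices, and
  \<open>n\<close> tends to infinity on both sides. Since 1 / (1 + a) = exp (- ln (1 + a)), what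
  remains is the Laplace functional at ln (1 + a), whose integrand 1 - exp (- ln (1 + a)) equals a /
  (1 + a).\<close>

lemma poisson_exp_marks_laplace:
  fixes a :: "'b \<Rightarrow> real"
  assumes P: "poisson_point_process \<mu> \<kappa> X" and Z: "indep_exp_marks \<mu> \<kappa> X \<zeta>"
    and B: "B \<in> sets \<mu>" "emeasure \<mu> B < \<infinity>"
    and a [measurable]: "a \<in> borel_measurable \<mu>" and nonneg: "\<And>x. x \<in> space \<mu> \<Longrightarrow> 0 \<le> a x"
    and supp: "\<And>x. x \<in> space \<mu> \<Longrightarrow> x \<notin> B \<Longrightarrow> a x = 0"
  shows "(\<integral>\<omega>. exp (- (\<Sum>k. if enat k < \<kappa> \<omega> then a (X k \<omega>) * \<zeta> k \<omega> else 0)) \<partial>M) =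
    exp (- (\<integral>x. a x / (1 + a x) \<partial>\<mu>))"
proof -
  note [measurable] = poisson_point_processD(1,2)[OF P] indep_exp_marksD(3)[OF Z]
  define A where "A k \<omega> = (if enat k < \<kappa> \<omega> then a (X k \<omega>) else 0)" for k \<omega>
  have A_meas [measurable]: "A k \<in> borel_measurable M" for k
    unfolding A_def by measurable
  have sp: "X k \<omega> \<in> space \<mu>" if "\<omega> \<in> space M" for k \<omega>
    using that measurable_space[OF poisson_point_processD(2)[OF P]] by auto
  have A_nonneg: "0 \<le> A k \<omega>" if "\<omega> \<in> space M" for k \<omega>
    using nonneg[OF sp[OF that]] by (simp add: A_def)
  have A_supp: "A k \<omega> = 0" if "\<omega> \<in> space M" "k \<notin> {k. enat k < \<kappa> \<omega> \<and> X k \<omega> \<in> B}" for k \<omega>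
    using supp[OF sp[OF that(1)], of k] that by (auto simp: A_def)
  \<comment> \<open>The form of \<open>f\<close> covers both sides of the limit: multiplication by
    the mark, and ln (1 + x). Since \<open>f k\<close> vanishes at 0, only the finitely many points
    in \<open>B\<close> contribute.\<close>
  have lim: "(\<lambda>n. exp (- (\<Sum>k<n. f k (A k \<omega>)))) \<longlonglongrightarrow> exp (- (\<Sum>k. f k (A k \<omega>)))"
    if fin: "finite {k. enat k < \<kappa> \<omega> \<and> X k \<omega> \<in> B}" and \<omega>: "\<omega> \<in> space M" and f: "\<And>k. f k 0 = 0"
    for \<omega> and f :: "nat \<Rightarrow> real \<Rightarrow> real"
    using A_supp[OF \<omega>] f by (intro tendsto_intros summable_LIMSEQ summable_finite[OF fin]) auto
  \<comment> \<open>Marks are nonnegative only almost surely; this gives the bound 1 for the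
    exponentials that contain them.\<close>
  have AE_nonneg: "AE \<omega> in M. \<forall>k. 0 \<le> \<zeta> k \<omega>"
    using exponential_AE_nonneg[OF indep_exp_marksD(1)[OF Z]] by (simp add: AE_all_countable)
  have "(\<lambda>n. \<integral>\<omega>. exp (- (\<Sum>k<n. A k \<omega> * \<zeta> k \<omega>)) \<partial>M) \<longlonglongrightarrow> (\<integral>\<omega>. exp (- (\<Sum>k. A k \<omega> * \<zeta> k \<omega>)) \<partial>M)"
  proof (rule integral_dominated_convergence[where w = "\<lambda>_. 1"])
    show "AE \<omega> in M. (\<lambda>n. exp (- (\<Sum>k<n. A k \<omega> * \<zeta> k \<omega>))) \<longlonglongrightarrow> exp (- (\<Sum>k. A k \<omega> * \<zeta> k \<omega>))"
      using poisson_AE_finite_points[OF P B] AE_space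
      by eventually_elim (auto intro: lim[of _ "\<lambda>k x. x * \<zeta> k _"])
    show "AE \<omega> in M. norm (exp (- (\<Sum>k<n. A k \<omega> * \<zeta> k \<omega>))) \<le> 1" for n
      using AE_nonneg AE_space by eventually_elim (simp add: sum_nonneg A_nonneg)
  qed auto
  moreover have "(\<lambda>n. \<integral>\<omega>. exp (- (\<Sum>k<n. ln (1 + A k \<omega>))) \<partial>M) \<longlonglongrightarrow> (\<integral>\<omega>. exp (- (\<Sum>k. ln (1 + A k \<omega>))) \<partial>M)"
  proof (rule integral_dominated_convergence[where w = "\<lambda>_. 1"])
    show "AE \<omega> in M. (\<lambda>n. exp (- (\<Sum>k<n. ln (1 + A k \<omega>)))) \<longlonglongrightarrow> exp (- (\<Sum>k. ln (1 + A k \<omega>)))"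
      using poisson_AE_finite_points[OF P B] AE_space
      by eventually_elim (auto intro: lim[of _ "\<lambda>k x. ln (1 + x)"])
    show "AE \<omega> in M. norm (exp (- (\<Sum>k<n. ln (1 + A k \<omega>)))) \<le> 1" for n
      using AE_space by eventually_elim (simp add: sum_nonneg A_nonneg)
  qed auto
  moreover have "(\<integral>\<omega>. exp (- (\<Sum>k<n. A k \<omega> * \<zeta> k \<omega>)) \<partial>M) = (\<integral>\<omega>. exp (- (\<Sum>k<n. ln (1 + A k \<omega>))) \<partial>M)" for n
  proof -
    have "(\<integral>\<omega>. exp (- (\<Sum>k<n. A k \<omega> * \<zeta> k \<omega>)) \<partial>M) = (\<integral>\<omega>. (\<Prod>k<n. exp (- A k \<omega> * \<zeta> k \<omega>)) \<partial>M)"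
      by (simp add: exp_sum sum_negf[symmetric] del: sum_negf)
    also have "\<dots> = (\<integral>\<omega>. (\<Prod>k<n. 1 / (1 + A k \<omega>)) \<partial>M)"
      unfolding A_def
      by (rule exp_marks_integrate_out[OF poisson_point_processD(1,2)[OF P] Z a nonneg])
    also have "\<dots> = (\<integral>\<omega>. exp (- (\<Sum>k<n. ln (1 + A k \<omega>))) \<partial>M)"
    proof (rule Bochner_Integration.integral_cong[OF refl])
      fix \<omega> assume \<omega>: "\<omega> \<in> space M"
      have "0 < 1 + A k \<omega>" for k
        using A_nonneg[OF \<omega>, of k] by simp
      then show "(\<Prod>k<n. 1 / (1 + A k \<omega>)) = exp (- (\<Sum>k<n. ln (1 + A k \<omega>)))"
        by (simp add: exp_minus exp_sum prod_dividef inverse_eq_divide)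
    qed
    finally show ?thesis .
  qed
  ultimately have "(\<integral>\<omega>. exp (- (\<Sum>k. A k \<omega> * \<zeta> k \<omega>)) \<partial>M) = (\<integral>\<omega>. exp (- (\<Sum>k. ln (1 + A k \<omega>))) \<partial>M)"
    by (simp add: LIMSEQ_unique)
  also have "\<dots> = (\<integral>\<omega>. exp (- (\<Sum>k. if enat k < \<kappa> \<omega> then ln (1 + a (X k \<omega>)) else 0)) \<partial>M)"
    by (simp add: A_def if_distrib cong: if_cong)
  also have "\<dots> = exp (- (\<integral>x. 1 - exp (- ln (1 + a x)) \<partial>\<mu>))"
    by (rule poisson_laplace_functional[OF P B]) (use nonneg supp in auto)
  also have "(\<integral>x. 1 - exp (- ln (1 + a x)) \<partial>\<mu>) = (\<integral>x. a x / (1 + a x) \<partial>\<mu>)"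
  proof (rule Bochner_Integration.integral_cong[OF refl])
    fix x assume "x \<in> space \<mu>"
    then have "0 < 1 + a x" using nonneg[of x] by simp
    then show "1 - exp (- ln (1 + a x)) = a x / (1 + a x)"
      by (simp add: exp_minus field_simps)
  qed
  finally show ?thesis
    by (simp add: A_def if_distrib[of "\<lambda>x. x * _"] cong: if_cong)
qed

end

section \<open>Measurability and evaluation of the averaged interference\<close>

text \<open>Real families are summable exactly when absolutely summable, which the extended
  nonnegative series detects; otherwise \<open>infsum\<close> takes its default value 0. In this
  form a random index set \<open>S\<close> only enters through a condition inside countable sums, so
  measurability can be derived.\<close>

lemma infsum_nat_real:
  fixes g :: "nat \<Rightarrow> real"
  shows "infsum g S = (if (\<Sum>k. ennreal \<bar>if k \<in> S then g k else 0\<bar>) = \<top> then 0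
    else (\<Sum>k. if k \<in> S then g k else 0))"
proof -
  define f where "f k = (if k \<in> S then g k else 0)" for k
  have "infsum g S = infsum f UNIV"
    by (rule infsum_cong_neutral) (auto simp: f_def)
  also have "\<dots> = (if (\<Sum>k. ennreal \<bar>f k\<bar>) = \<top> then 0 else suminf f)"
  proof (cases "(\<Sum>k. ennreal \<bar>f k\<bar>) = \<top>")
    case True
    have "\<not> f summable_on UNIV"
    proof
      assume "f summable_on UNIV"
      then have "(\<lambda>k. \<bar>f k\<bar>) summable_on UNIV"
        using summable_on_iff_abs_summable_on_real[THEN iffD1] by fastforce
      then have "summable (\<lambda>k. \<bar>f k\<bar>)"
        by (rule summable_on_imp_summable)
      then have "(\<Sum>k. ennreal \<bar>f k\<bar>) \<noteq> \<top>"
        by (rule ennreal_suminf_neq_top) simp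
      then show False
        using True by contradiction
    qed
    then show ?thesis
      using True by (simp add: infsum_not_exists)
  next
    case False
    then have norm_f: "summable (\<lambda>k. norm (f k))"
      unfolding real_norm_def by (intro summable_suminf_not_top) auto
    then have "(f has_sum suminf f) UNIV"
      using summable_sums[OF summable_norm_cancel[OF norm_f]] by (rule norm_summable_imp_has_sum)
    then show ?thesis
      using False by (simp add: infsumI)
  qed
  finally show ?thesis
    by (simp add: f_def[abs_def])
qed

text \<open>
  Knowing the averaged interference up to a null event does not suffice: \<open>M\<close> need not be complete,
  and the Bochner integral of a non-measurable function is 0.
\<close>

lemma borel_measurable_avg_interference:
  fixes Q :: real
  assumes [measurable]: "\<kappa> \<in> measurable M (count_space UNIV)"
    "\<And>k. (\<lambda>\<omega>. snd (X k \<omega>)) \<in> borel_measurable M" "\<And>k. \<zeta> k \<in> borel_measurable M"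
  shows "avg_interference (\<lambda>w h. Q * h) T \<kappa> X \<zeta> \<in> borel_measurable M"
proof -
  \<comment> \<open>Joint measurability in outcome and time is what makes the time integral
    measurable in the outcome.\<close>
  have "(\<lambda>(\<omega>, t). interference (\<lambda>w h. Q * h) T \<kappa> X \<zeta> t \<omega>) \<in> borel_measurable (M \<Otimes>\<^sub>M lborel)"
    unfolding interference_def infsum_nat_real mem_Collect_eq case_prod_unfold by measurable
  then have "(\<lambda>(\<omega>, t). indicator {0..T} t *\<^sub>R interference (\<lambda>w h. Q * h) T \<kappa> X \<zeta> t \<omega>)
      \<in> borel_measurable (M \<Otimes>\<^sub>M lborel)"
    by (simp add: case_prod_unfold)
  then have "(\<lambda>\<omega>. LBINT t. indicator {0..T} t *\<^sub>R interference (\<lambda>w h. Q * h) T \<kappa> X \<zeta> t \<omega>) \<in> borel_measurable M"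
    by (rule lborel.borel_measurable_lebesgue_integral)
  then show ?thesis
    unfolding avg_interference_def[abs_def] set_lebesgue_integral_def by simp
qed

text \<open>Finitely many packets can be on air during the window, so the time integral passes
  through the sum and leaves for each packet the length of its overlap with the window.\<close>

lemma avg_interference_eq_sum:
  fixes Q :: real
  assumes T: "T > 0"
    and K_eq: "K = {k. enat k < \<kappa> \<omega> \<and> snd (X k \<omega>) \<in> {-T..T}}" and K: "finite K"
  shows "avg_interference (\<lambda>w h. Q * h) T \<kappa> X \<zeta> \<omega> =
    (\<Sum>k\<in>K. Q * max 0 (1 - \<bar>snd (X k \<omega>)\<bar> / T) * \<zeta> k \<omega>)"
proof -
  \<comment> \<open>The times in the window at which packet \<open>k\<close> is on air.\<close>
  define S where "S k = {0..T} \<inter> {snd (X k \<omega>)..<snd (X k \<omega>) + T}" for k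
  have S: "measure lborel (S k) = T * max 0 (1 - \<bar>snd (X k \<omega>)\<bar> / T)"
    "S k \<in> sets lborel" "emeasure lborel (S k) < \<infinity>"
    if "k \<in> K" for k
  proof -
    let ?s = "snd (X k \<omega>)"
    have s: "-T \<le> ?s" "?s \<le> T" using that by (auto simp: K_eq)
    \<comment> \<open>A packet starting after 0 outlasts the window, any other one ends within it.
      Both overlaps have length T - \<bar>s\<bar>; at the ends s = -T and s = T the set is empty or
      a single point, so the length is 0.\<close>
    have eq: "S k = (if 0 < ?s then {?s..T} else {0..<?s + T})"
      by (auto simp: S_def)
    show "measure lborel (S k) = T * max 0 (1 - \<bar>?s\<bar> / T)"
      using s T by (auto simp: eq max_def field_simps)
    show "S k \<in> sets lborel" "emeasure lborel (S k) < \<infinity>"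
      using s by (auto simp: eq)
  qed
  have "(LBINT t:{0..T}. interference (\<lambda>w h. Q * h) T \<kappa> X \<zeta> t \<omega>) =
      (LBINT t. (\<Sum>k\<in>K. Q * \<zeta> k \<omega> * indicator (S k) t))"
    unfolding set_lebesgue_integral_def
  proof (rule Bochner_Integration.integral_cong[OF refl])
    fix t
    show "indicator {0..T} t *\<^sub>R interference (\<lambda>w h. Q * h) T \<kappa> X \<zeta> t \<omega> =
      (\<Sum>k\<in>K. Q * \<zeta> k \<omega> * indicator (S k) t)"
    proof (cases "t \<in> {0..T}")
      case True
      \<comment> \<open>Every packet on air at a time of the window starts in [-T, T]; members of
        \<open>K\<close> that are silent at time \<open>t\<close> have indicator 0.\<close>
      have "interference (\<lambda>w h. Q * h) T \<kappa> X \<zeta> t \<omega> = (\<Sum>\<^sub>\<infinity>k\<in>K. Q * \<zeta> k \<omega> * indicator (S k) t)"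
        unfolding interference_def
        by (rule infsum_cong_neutral) (use True in \<open>auto simp: K_eq S_def indicator_def\<close>)
      then show ?thesis using True K by simp
    qed (auto simp: S_def intro!: sum.neutral)
  qed
  also have "\<dots> = (\<Sum>k\<in>K. LBINT t. Q * \<zeta> k \<omega> * indicator (S k) t)"
    using S(2,3) by (intro Bochner_Integration.integral_sum) auto
  also have "\<dots> = (\<Sum>k\<in>K. Q * \<zeta> k \<omega> * (T * max 0 (1 - \<bar>snd (X k \<omega>)\<bar> / T)))"
    using S by (intro sum.cong) auto
  finally show ?thesis
    using T by (simp add: avg_interference_def sum_distrib_left mult_ac)
qed

section \<open>Integration against the rain intensity\<close>

lemma cell_ring_sets [measurable]: "cell_ring r_in r_out \<in> sets borel"
  unfolding cell_ring_def by measurable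

lemma emeasure_cell_ring:
  assumes "0 \<le> r_in" "r_in < r_out"
  shows "emeasure lborel (cell_ring r_in r_out) = ennreal (ring_area r_in r_out)"
proof -
  have "cell_ring r_in r_out = cball 0 r_out - ball 0 r_in"
    by (auto simp: cell_ring_def)
  then have "emeasure lborel (cell_ring r_in r_out) =
      emeasure lborel (cball 0 r_out :: (real^2) set) - emeasure lborel (ball 0 r_in :: (real^2) set)"
    using assms by (simp only:) (rule emeasure_Diff, simp_all add: emeasure_ball ball_subset_cball_iff)
  also have "\<dots> = ennreal (pi * r_out\<^sup>2) - ennreal (pi * r_in\<^sup>2)"
    using assms by (simp add: emeasure_ball emeasure_cball unit_ball_vol_2)
  also have "\<dots> = ennreal (ring_area r_in r_out)"
    using assms by (simp add: ennreal_minus ring_area_def right_diff_distrib)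
  finally show ?thesis .
qed

lemma space_rain_intensity: "space (rain_intensity r_in r_out lam \<Delta> T) = cell_ring r_in r_out \<times> UNIV"
  by (simp add: rain_intensity_def space_scale_measure space_restrict_space)

lemma measurable_rain_intensity:
  assumes [measurable]: "f \<in> borel_measurable borel"
  shows "(\<lambda>x. f (snd x)) \<in> borel_measurable (rain_intensity r_in r_out lam \<Delta> T)"
proof -
  have "(\<lambda>x::(real^2) \<times> real. f (snd x)) \<in> borel_measurable borel"
    by (subst borel_prod[symmetric]) measurable
  then show ?thesis
    unfolding rain_intensity_def
    by (simp add: measurable_cong_sets[OF sets_scale_measure refl] measurable_restrict_space1)
qed

text \<open>Power control removes the location from the received power, so integrands in the start
  time are enough. Tonelli then splits off the area of the ring.\<close>

lemma nn_integral_rain_intensity: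
  assumes r: "0 \<le> r_in" "r_in < r_out" and f [measurable]: "f \<in> borel_measurable borel"
  shows "(\<integral>\<^sup>+x. f (snd x) \<partial>rain_intensity r_in r_out lam \<Delta> T) =
    ennreal (lam * packet_rate \<Delta> T) * (ennreal (ring_area r_in r_out) * (\<integral>\<^sup>+t. f t \<partial>lborel))"
proof -
  let ?R = "cell_ring r_in r_out"
  have R: "?R \<times> (UNIV::real set) \<in> sets borel"
    by (subst borel_prod[symmetric]) simp
  have f': "(\<lambda>x::(real^2) \<times> real. f (snd x)) \<in> borel_measurable borel"
    by (subst borel_prod[symmetric]) measurable
  have "(\<integral>\<^sup>+x. f (snd x) \<partial>rain_intensity r_in r_out lam \<Delta> T) =
      ennreal (lam * packet_rate \<Delta> T) * (\<integral>\<^sup>+x. f (snd x) \<partial>restrict_space lborel (?R \<times> UNIV))"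
    unfolding rain_intensity_def using f'
    by (intro nn_integral_scale_measure measurable_restrict_space1) auto
  also have "(\<integral>\<^sup>+x. f (snd x) \<partial>restrict_space lborel (?R \<times> UNIV)) =
      (\<integral>\<^sup>+x. f (snd x) * indicator (?R \<times> UNIV) x \<partial>lborel)"
    using R by (intro nn_integral_restrict_space) auto
  also have "\<dots> = (\<integral>\<^sup>+x. indicator ?R (fst x) * f (snd x) \<partial>(lborel \<Otimes>\<^sub>M lborel))"
    unfolding lborel_prod by (intro nn_integral_cong) (auto simp: indicator_def)
  also have "\<dots> = (\<integral>\<^sup>+w. \<integral>\<^sup>+t. indicator ?R w * f t \<partial>lborel \<partial>lborel)"
    by (subst lborel.nn_integral_fst[symmetric]) auto
  also have "\<dots> = ennreal (ring_area r_in r_out) * (\<integral>\<^sup>+t. f t \<partial>lborel)"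
    by (simp add: nn_integral_cmult nn_integral_multc emeasure_cell_ring[OF r])
  finally show ?thesis .
qed

text \<open>The integrand is even. On [0, T] it is u / (1 + u) = 1 - 1 / (1 + u) with u = b * (1 - t
  / T), which has an elementary antiderivative.\<close>

lemma nn_integral_triangular_fraction:
  fixes b T :: real
  assumes b: "b > 0" and T: "T > 0"
  defines "q \<equiv> \<lambda>t. b * max 0 (1 - \<bar>t\<bar> / T)"
  shows "(\<integral>\<^sup>+t. ennreal (q t / (1 + q t)) \<partial>lborel) = ennreal (2 * T * (1 - ln (1 + b) / b))"
proof -
  define g where "g t = b * (1 - t / T) / (1 + b * (1 - t / T))" for t
  define G where "G t = t + T / b * ln (1 + b * (1 - t / T))" for t
  have pos: "0 < 1 + b * (1 - t / T)" if "t \<le> T" for t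
    using that b T by (simp add: add_pos_nonneg)
  have g_nonneg: "0 \<le> g t" if "t \<le> T" for t
    using pos[OF that] that b T by (simp add: g_def)
  have G_deriv: "(G has_real_derivative g t) (at t)" if "t \<le> T" for t
  proof -
    have "(G has_real_derivative 1 + T / b * ((- b / T) / (1 + b * (1 - t / T)))) (at t)"
      unfolding G_def[abs_def] using pos[OF that] by (auto intro!: derivative_eq_intros)
    also have "1 + T / b * ((- b / T) / u) = (u - 1) / u" if "u > 0" for u
      using that b T by (simp add: field_simps)
    from this[OF pos[OF that]] have "1 + T / b * ((- b / T) / (1 + b * (1 - t / T))) = g t"
      by (simp add: g_def)
    finally show ?thesis .
  qed
  have [measurable]: "g \<in> borel_measurable borel"
    unfolding g_def[abs_def] by measurable
  have half: "(\<integral>\<^sup>+t. ennreal (g t) * indicator {0..T} t \<partial>lborel) = ennreal (T * (1 - ln (1 + b) / b))"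
  proof -
    have "(\<integral>\<^sup>+t. ennreal (g t) * indicator {0..T} t \<partial>lborel) = ennreal (G T - G 0)"
      by (rule nn_integral_FTC_Icc) (use G_deriv g_nonneg T in \<open>auto intro: has_field_derivative_at_within\<close>)
    also have "G T - G 0 = T * (1 - ln (1 + b) / b)"
      using T b by (simp add: G_def field_simps)
    finally show ?thesis .
  qed
  \<comment> \<open>The substitution t to -t carries the negative half to the positive one.\<close>
  have reflect: "(\<integral>\<^sup>+t. ennreal (g (- t)) * indicator {0..T} (- t) \<partial>lborel) =
      (\<integral>\<^sup>+t. ennreal (g t) * indicator {0..T} t \<partial>lborel)"
    by (subst (2) nn_integral_real_affine[where c = "-1" and t = 0]) auto
  have "(\<integral>\<^sup>+t. ennreal (q t / (1 + q t)) \<partial>lborel) =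
      (\<integral>\<^sup>+t. ennreal (g t) * indicator {0..T} t + ennreal (g (- t)) * indicator {0..T} (- t) \<partial>lborel)"
  proof (rule nn_integral_cong_AE)
    show "AE t in lborel. ennreal (q t / (1 + q t)) =
        ennreal (g t) * indicator {0..T} t + ennreal (g (- t)) * indicator {0..T} (- t)"
      \<comment> \<open>At 0 both indicators are 1 and the integrand would be counted twice.\<close>
      using AE_lborel_singleton[of 0]
    proof eventually_elim
      case (elim t)
      then show ?case
        using T by (cases "\<bar>t\<bar> \<le> T") (auto simp: q_def g_def indicator_def max_def field_simps abs_if)
    qed
  qed
  also have "\<dots> = ennreal (T * (1 - ln (1 + b) / b)) + ennreal (T * (1 - ln (1 + b) / b))"
    by (subst nn_integral_add) (auto simp: reflect half)
  also have "\<dots> = ennreal (2 * T * (1 - ln (1 + b) / b))"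
  proof -
    \<comment> \<open>Nonnegativity is required because \<open>ennreal\<close> sends negative reals
      to 0.\<close>
    have "ln (1 + b) \<le> b" using ln_add_one_self_le_self[of b] b by simp
    then have "0 \<le> T * (1 - ln (1 + b) / b)" using b T by simp
    then show ?thesis by (simp flip: ennreal_plus)
  qed
  finally show ?thesis .
qed

section \<open>Assembly of the Laplace transform\<close>

theorem proposition1:
  fixes M :: "'a measure"
    and \<kappa> :: "'a \<Rightarrow> enat"
    and X :: "nat \<Rightarrow> 'a \<Rightarrow> (real^2) \<times> real"
    and \<zeta> :: "nat \<Rightarrow> 'a \<Rightarrow> real"
    and H \<alpha>\<^sub>0 n\<^sub>0 P_edge r_in r_out lam \<Delta> T z :: real
  assumes "H > 0" and "\<alpha>\<^sub>0 > 0" and "n\<^sub>0 \<ge> 2" and "P_edge > 0"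
    and "0 \<le> r_in" and "r_in < r_out"
    and "lam > 0" and "T > 0" and "0 \<le> \<Delta>" and "\<Delta> < 1"
    and "prob_space M"
    and "prob_space.poisson_point_process M (rain_intensity r_in r_out lam \<Delta> T) \<kappa> X"
    and "prob_space.indep_exp_marks M (rain_intensity r_in r_out lam \<Delta> T) \<kappa> X \<zeta>"
    and "z > 0"
  shows "laplace_transform M
           (avg_interference (rx_power \<alpha>\<^sub>0 H n\<^sub>0 P_edge r_out) T \<kappa> X \<zeta>) z =
         exp (- 2 * lam * \<Delta> / (1 - \<Delta>) *
           E_cell (ring_area r_in r_out) (mean_rx_power \<alpha>\<^sub>0 H n\<^sub>0 P_edge r_out) z)"
proof -
  interpret prob_space M by fact
  define \<mu> where "\<mu> = rain_intensity r_in r_out lam \<Delta> T"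
  define Q where "Q = mean_rx_power \<alpha>\<^sub>0 H n\<^sub>0 P_edge r_out"
  define c where "c = lam * packet_rate \<Delta> T"
  define q where "q t = z * Q * max 0 (1 - \<bar>t\<bar> / T)" for t
  \<comment> \<open>Packets that meet the window start in [-T, T], and this bounded part of
    space-time has finite intensity.\<close>
  define B where "B = cell_ring r_in r_out \<times> {-T..T}"
  have P: "poisson_point_process \<mu> \<kappa> X" and Z: "indep_exp_marks \<mu> \<kappa> X \<zeta>"
    using assms by (auto simp: \<mu>_def)
  have rx: "rx_power \<alpha>\<^sub>0 H n\<^sub>0 P_edge r_out = (\<lambda>w h. Q * h)"
    using assms by (simp add: fun_eq_iff rx_power_eq Q_def)
  have "H\<^sup>2 + r_out\<^sup>2 > 0"
    using assms by (simp add: add_pos_nonneg)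
  then have Q: "Q > 0"
    using assms by (simp add: Q_def mean_rx_power_def)
  have c: "c \<ge> 0"
    using assms by (simp add: c_def packet_rate_def)
  have area: "ring_area r_in r_out \<ge> 0"
    using assms by (simp add: ring_area_def power_mono)
  have q_nonneg: "0 \<le> q t" for t
    using Q assms by (simp add: q_def)
  have q_meas [measurable]: "q \<in> borel_measurable borel"
    unfolding q_def[abs_def] by measurable
  have nn: "(\<integral>\<^sup>+x. f (snd x) \<partial>\<mu>) = ennreal c * (ennreal (ring_area r_in r_out) * (\<integral>\<^sup>+t. f t \<partial>lborel))"
    if "f \<in> borel_measurable borel" for f
    unfolding \<mu>_def c_def using assms that by (intro nn_integral_rain_intensity) auto
  have meas_snd: "(\<lambda>x. f (snd x)) \<in> borel_measurable \<mu>" if "f \<in> borel_measurable borel" for f :: "real \<Rightarrow> real"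
    unfolding \<mu>_def using that by (rule measurable_rain_intensity)
  have space: "space \<mu> = cell_ring r_in r_out \<times> UNIV"
    by (simp add: \<mu>_def space_rain_intensity)
  \<comment> \<open>As a preimage under the start time, \<open>B\<close> falls under
    \<open>meas_snd\<close> and \<open>nn\<close>.\<close>
  have B_eq: "B = (\<lambda>x. snd x) -` {-T..T} \<inter> space \<mu>"
    by (auto simp: B_def space)
  have B: "B \<in> sets \<mu>"
    unfolding B_eq using meas_snd[of "\<lambda>x. x"] by (intro measurable_sets[where A = borel]) auto
  have "emeasure \<mu> B = (\<integral>\<^sup>+x. indicator {-T..T} (snd x) \<partial>\<mu>)"
    unfolding nn_integral_indicator[OF B, symmetric]
    by (intro nn_integral_cong) (auto simp: B_eq indicator_def)
  also have "\<dots> < \<infinity>"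
    using assms by (subst nn) (auto simp: ennreal_mult_less_top)
  finally have B_fin: "emeasure \<mu> B < \<infinity>" .
  have avg_meas [measurable]: "avg_interference (\<lambda>w h. Q * h) T \<kappa> X \<zeta> \<in> borel_measurable M"
    using measurable_compose[OF poisson_point_processD(2)[OF P] meas_snd[of "\<lambda>x. x"]]
    by (intro borel_measurable_avg_interference poisson_point_processD(1)[OF P] indep_exp_marksD(3)[OF Z]) auto
  have qX_meas [measurable]: "(\<lambda>\<omega>. q (snd (X k \<omega>))) \<in> borel_measurable M" for k
    using measurable_compose[OF poisson_point_processD(2)[OF P] meas_snd[OF q_meas]] .
  note [measurable] = poisson_point_processD(1)[OF P] indep_exp_marksD(3)[OF Z]
  have "laplace_transform M (avg_interference (rx_power \<alpha>\<^sub>0 H n\<^sub>0 P_edge r_out) T \<kappa> X \<zeta>) z =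
      (\<integral>\<omega>. exp (- z * avg_interference (\<lambda>w h. Q * h) T \<kappa> X \<zeta> \<omega>) \<partial>M)"
    by (simp add: laplace_transform_def rx)
  also have "\<dots> = (\<integral>\<omega>. exp (- (\<Sum>k. if enat k < \<kappa> \<omega> then q (snd (X k \<omega>)) * \<zeta> k \<omega> else 0)) \<partial>M)"
  \<comment> \<open>The two integrands agree only almost surely, so both must be measurable; for the
    left one this is \<open>avg_meas\<close>.\<close>
  proof (rule integral_cong_AE)
    show "AE \<omega> in M. exp (- z * avg_interference (\<lambda>w h. Q * h) T \<kappa> X \<zeta> \<omega>) =
        exp (- (\<Sum>k. if enat k < \<kappa> \<omega> then q (snd (X k \<omega>)) * \<zeta> k \<omega> else 0))"
      using poisson_AE_finite_points[OF P B B_fin] AE_space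
    proof eventually_elim
      case (elim \<omega>)
      define K where "K = {k. enat k < \<kappa> \<omega> \<and> snd (X k \<omega>) \<in> {-T..T}}"
      have "X k \<omega> \<in> space \<mu>" for k
        using measurable_space[OF poisson_point_processD(2)[OF P] elim(2)] .
      then have K: "finite K"
        using elim(1) by (simp add: K_def B_eq)
      have "(\<Sum>k. if enat k < \<kappa> \<omega> then q (snd (X k \<omega>)) * \<zeta> k \<omega> else 0) =
          (\<Sum>k\<in>K. if enat k < \<kappa> \<omega> then q (snd (X k \<omega>)) * \<zeta> k \<omega> else 0)"
        using assms(8) by (intro suminf_finite[OF K]) (auto simp: K_def q_def max_def field_simps)
      also have "\<dots> = (\<Sum>k\<in>K. q (snd (X k \<omega>)) * \<zeta> k \<omega>)"
        by (intro sum.cong) (auto simp: K_def)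
      also have "\<dots> = z * avg_interference (\<lambda>w h. Q * h) T \<kappa> X \<zeta> \<omega>"
        by (subst avg_interference_eq_sum[of T K \<kappa> \<omega> X])
           (use assms(8) K K_def in \<open>simp_all add: q_def sum_distrib_left mult_ac\<close>)
      finally show ?case by simp
    qed
  qed measurable
  also have "\<dots> = exp (- (\<integral>x. q (snd x) / (1 + q (snd x)) \<partial>\<mu>))"
  proof (rule poisson_exp_marks_laplace[OF P Z B B_fin])
    show "q (snd x) = 0" if "x \<in> space \<mu>" "x \<notin> B" for x
      using that assms(8) by (auto simp: B_eq q_def max_def field_simps)
  qed (use q_nonneg meas_snd[OF q_meas] in auto)
  also have "(\<integral>x. q (snd x) / (1 + q (snd x)) \<partial>\<mu>) =
      c * (ring_area r_in r_out * (2 * T * (1 - ln (1 + z * Q) / (z * Q))))"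
  proof -
    have "(\<integral>\<^sup>+x. ennreal (q (snd x) / (1 + q (snd x))) \<partial>\<mu>) =
        ennreal c * (ennreal (ring_area r_in r_out) * ennreal (2 * T * (1 - ln (1 + z * Q) / (z * Q))))"
      using nn_integral_triangular_fraction[of "z * Q" T] assms Q
      by (subst nn) (auto simp: q_def)
    moreover have "0 \<le> 2 * T * (1 - ln (1 + z * Q) / (z * Q))"
      using ln_add_one_self_le_self[of "z * Q"] assms Q by simp
    ultimately show ?thesis
      using c area q_nonneg meas_snd[of "\<lambda>t. q t / (1 + q t)"]
      by (subst integral_eq_nn_integral) (auto simp flip: ennreal_mult)
  qed
  also have "- (c * (ring_area r_in r_out * (2 * T * (1 - ln (1 + z * Q) / (z * Q))))) =
      - 2 * lam * \<Delta> / (1 - \<Delta>) * E_cell (ring_area r_in r_out) Q z"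
  proof -
    have "ln (1 / (1 + Q * z)) = - ln (1 + z * Q)"
      using Q assms by (subst ln_div) (auto simp: add_pos_pos mult_ac)
    then have E: "E_cell (ring_area r_in r_out) Q z = ring_area r_in r_out * (1 - ln (1 + z * Q) / (z * Q))"
      by (simp add: E_cell_def mult.commute)
    \<comment> \<open>The packet rate carries a factor 1 / T, which cancels the \<open>T\<close>
      from the time integral; the 2 from its two halves is the 2 in the exponent.\<close>
    have cT: "c * T = lam * \<Delta> / (1 - \<Delta>)"
      using assms by (simp add: c_def packet_rate_def)
    have "- (c * (A * (2 * T * F))) = - 2 * (c * T) * (A * F)" for A F
      by simp
    then show ?thesis
      unfolding E cT by simp
  qed
  finally show ?thesis
    by (simp add: Q_def)
qed

end
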